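(* Let $\mathbb{R}^n$ be endowed with the Cartesian product order: $x\le y$ iff $x_k\le y_k$ for $k=1,\ldots,n$. Let $X\subset\mathbb{R}^n$ be a compact subset endowed with the induced topology and the induced order (denoted in the same way). Let $S$ be the family of positive isotone rational functions $f:=p(x)/q(x)$ on $X$ such that (i) the coefficients of the polynomials $p$ and $q$ are non-negative, (ii) $\deg(p)=\deg(q)$. Then $\bar S=C^+(X,\le,\mathbb{R})$.
   Context: A function $f:X\to\mathbb{R}$ is isotone if $x\le y$ implies $f(x)\le f(y)$. $C^+(X,\le,\mathbb{R})$ is the set of non-negative continuous isotone functions $X\to\mathbb{R}$. $\bar S$ is the closure of $S$ in $C(X,\mathbb{R})$ with respect to the uniform (sup) norm on $X$. Polynomials are real polynomials in $n$ variables and $\deg$ is the total degree. A rational function $p/q$ on $X$ is understood to be defined at every point of $X$, with $q$ nowhere zero on $X$; "positive" means $f(x)>0$ for all $x\in X$. *)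

theory Defs
  imports "HOL-Analysis.Analysis" "HOL-Library.Poly_Mapping"
begin

text \<open>
  A monomial assigns an exponent to each variable; a polynomial assigns a coefficient to
  each monomial, all but finitely many being zero.
\<close>

type_synonym 'n monomial = "'n \<Rightarrow>\<^sub>0 nat"

type_synonym 'n real_mpoly = "'n monomial \<Rightarrow>\<^sub>0 real"

definition mpoly_eval :: "'n::finite real_mpoly \<Rightarrow> real ^ 'n \<Rightarrow> real" where
  "mpoly_eval p x =
     (\<Sum>m\<in>Poly_Mapping.keys p. Poly_Mapping.lookup p m * (\<Prod>i\<in>UNIV. (x $ i) ^ Poly_Mapping.lookup m i))"

text \<open>
  The inserted \<open>0\<close> only matters for the zero polynomial, whose degree is thereby \<open>0\<close>.
\<close>

definition total_degree :: "'n::finite real_mpoly \<Rightarrow> nat" where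
  "total_degree p = Max (insert 0 ((\<lambda>m. \<Sum>i\<in>UNIV. Poly_Mapping.lookup m i) ` Poly_Mapping.keys p))"

definition nonneg_coeffs :: "'n real_mpoly \<Rightarrow> bool" where
  "nonneg_coeffs p \<longleftrightarrow> (\<forall>m. 0 \<le> Poly_Mapping.lookup p m)"

text \<open>
  Functions on \<open>X\<close> are represented, as in \<^const>\<open>cfunspace\<close>, by functions on the whole type
  that are \<^const>\<open>undefined\<close> outside \<open>X\<close>. The bound built into \<^const>\<open>cfunspace\<close> is
  automatic for compact \<open>X\<close>, and its distance is the supremum distance on \<open>X\<close>.
\<close>

abbreviation cont_space :: "'a::topological_space set \<Rightarrow> ('a \<Rightarrow> real) metric" where
  "cont_space X \<equiv> cfunspace (top_of_set X) euclidean_metric"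

definition nonneg_isotone_cont :: "'a::{topological_space, ord} set \<Rightarrow> ('a \<Rightarrow> real) set" where
  "nonneg_isotone_cont X =
     {f \<in> mspace (cont_space X). (\<forall>x\<in>X. 0 \<le> f x) \<and> mono_on X f}"

text \<open>
  The order on \<^typ>\<open>real ^ 'n\<close> is the componentwise one (\<open>less_eq_vec_def\<close>).
\<close>

definition isotone_rational :: "(real ^ 'n) set \<Rightarrow> (real ^ 'n \<Rightarrow> real) set" where
  "isotone_rational X =
     {f. (\<forall>x\<in>X. 0 < f x) \<and> mono_on X f \<and>
         (\<exists>p q. nonneg_coeffs p \<and> nonneg_coeffs q \<and> total_degree p = total_degree q \<and>
                (\<forall>x\<in>X. mpoly_eval q x \<noteq> 0) \<and>
                f = restrict (\<lambda>x. mpoly_eval p x / mpoly_eval q x) X)}"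

end

theory Submission
  imports Defs
begin

text \<open>
  Isotone quotients \<open>p/q\<close> of the required kind contain the positive constants and are closed under
  sums, products and \<open>f \<mapsto> f / (1 + f)\<close>, which sends \<open>p/q\<close> to \<open>p/(q + p)\<close>. For \<open>a\<close> large, the
  functions \<open>(a + x\<^sub>k) / (a + 1 + x\<^sub>k)\<close> belong to the class and separate every pair with
  \<open>\<not> y \<le> x\<close> in the right direction. The sigmoids \<open>(f/c)\<^sup>m / (1 + (f/c)\<^sup>m)\<close> sharpen such a separation
  to a near-indicator function; products and sums, again sharpened, extend it by compactness to
  the sets \<open>{f \<le> u}\<close> and \<open>{v \<le> f}\<close> for \<open>u < v\<close>. A nonnegative isotone continuous \<open>f\<close> is then
  approximated by \<open>\<delta> (h\<^sub>0 + \<dots> + h\<^sub>n)\<close>, where \<open>h\<^sub>j\<close> is small on \<open>{f \<le> j\<delta>}\<close> and close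
  to \<open>1\<close> on \<open>{(j + 1)\<delta> \<le> f}\<close>.
\<close>

subsection \<open>Polynomials with nonnegative coefficients\<close>

definition monomial_degree :: "'n::finite monomial \<Rightarrow> nat" where
  "monomial_degree m = (\<Sum>i\<in>UNIV. Poly_Mapping.lookup m i)"

definition monomial_eval :: "'n::finite monomial \<Rightarrow> real ^ 'n \<Rightarrow> real" where
  "monomial_eval m x = (\<Prod>i\<in>UNIV. (x $ i) ^ Poly_Mapping.lookup m i)"

lemma monomial_degree_add: "monomial_degree (m + m') = monomial_degree m + monomial_degree m'"
  by (simp add: monomial_degree_def lookup_add sum.distrib)

lemma monomial_eval_add: "monomial_eval (m + m') x = monomial_eval m x * monomial_eval m' x"
  by (simp add: monomial_eval_def lookup_add power_add prod.distrib)

text \<open>\<open>mpoly_eval\<close> sums over a support that varies with the polynomial. Padding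
  it to a common finite set adds only zero terms and lets two polynomials be compared
  termwise.\<close>

lemma mpoly_eval_superset:
  assumes "finite K" "Poly_Mapping.keys p \<subseteq> K"
  shows "mpoly_eval p x = (\<Sum>m\<in>K. Poly_Mapping.lookup p m * monomial_eval m x)"
  unfolding mpoly_eval_def monomial_eval_def
  by (rule sum.mono_neutral_left) (use assms in \<open>auto simp: in_keys_iff\<close>)

lemma mpoly_eval_add: "mpoly_eval (p + q) x = mpoly_eval p x + mpoly_eval q x"
proof -
  let ?K = "Poly_Mapping.keys p \<union> Poly_Mapping.keys q"
  have "Poly_Mapping.keys (p + q) \<subseteq> ?K"
    by (rule keys_add)
  then show ?thesis
    by (simp add: mpoly_eval_superset[of ?K] lookup_add distrib_right sum.distrib)
qed

lemma mpoly_eval_0 [simp]: "mpoly_eval 0 x = 0"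
  by (simp add: mpoly_eval_def)

lemma mpoly_eval_sum: "mpoly_eval (\<Sum>i\<in>I. p i) x = (\<Sum>i\<in>I. mpoly_eval (p i) x)"
  by (induction I rule: infinite_finite_induct) (auto simp: mpoly_eval_add)

lemma mpoly_eval_single: "mpoly_eval (Poly_Mapping.single m c) x = c * monomial_eval m x"
  by (subst mpoly_eval_superset[of "{m}"]) auto

lemma poly_mapping_eq_sum_single:
  "p = (\<Sum>m\<in>Poly_Mapping.keys p. Poly_Mapping.single m (Poly_Mapping.lookup p m))"
  by (rule poly_mapping_eqI)
     (simp add: lookup_sum lookup_single when_def in_keys_iff)

text \<open>Expanding both factors into single terms gives a finite double sum in place of the
  convolution. Evaluation, signs and coefficients of products can then be read off term by
  term.\<close>

lemma mult_eq_sum_single: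
  fixes p q :: "'n real_mpoly"
  shows "p * q = (\<Sum>m\<in>Poly_Mapping.keys p. \<Sum>m'\<in>Poly_Mapping.keys q.
           Poly_Mapping.single (m + m') (Poly_Mapping.lookup p m * Poly_Mapping.lookup q m'))"
proof -
  have "p * q = (\<Sum>m\<in>Poly_Mapping.keys p. Poly_Mapping.single m (Poly_Mapping.lookup p m)) *
      (\<Sum>m'\<in>Poly_Mapping.keys q. Poly_Mapping.single m' (Poly_Mapping.lookup q m'))"
    by (simp flip: poly_mapping_eq_sum_single)
  then show ?thesis
    by (simp add: sum_product mult_single)
qed

lemma mpoly_eval_mult: "mpoly_eval (p * q) x = mpoly_eval p x * mpoly_eval q x"
proof -
  have "mpoly_eval (p * q) x = (\<Sum>m\<in>Poly_Mapping.keys p. \<Sum>m'\<in>Poly_Mapping.keys q.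
      (Poly_Mapping.lookup p m * monomial_eval m x) * (Poly_Mapping.lookup q m' * monomial_eval m' x))"
    unfolding mult_eq_sum_single
    by (simp add: mpoly_eval_sum mpoly_eval_single monomial_eval_add mult_ac)
  then show ?thesis
    by (simp add: mpoly_eval_superset[OF finite_keys order_refl] flip: sum_product)
qed

section \<open>Supports and degrees in the absence of cancellation\<close>

lemma nonneg_coeffs_add: "nonneg_coeffs p \<Longrightarrow> nonneg_coeffs q \<Longrightarrow> nonneg_coeffs (p + q)"
  by (simp add: nonneg_coeffs_def lookup_add)

lemma nonneg_coeffs_single: "0 \<le> c \<Longrightarrow> nonneg_coeffs (Poly_Mapping.single m c)"
  by (simp add: nonneg_coeffs_def lookup_single when_def)

lemma nonneg_coeffs_mult: "nonneg_coeffs p \<Longrightarrow> nonneg_coeffs q \<Longrightarrow> nonneg_coeffs (p * q)"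
  unfolding mult_eq_sum_single nonneg_coeffs_def
  by (auto simp: lookup_sum lookup_single when_def intro!: sum_nonneg)

text \<open>The coefficient of \<open>m + m'\<close> in the product is a sum of nonnegative terms,
  one of which is the left-hand side. So a product of two nonzero coefficients can never be
  cancelled.\<close>

lemma lookup_mult_ge:
  assumes "nonneg_coeffs p" "nonneg_coeffs q"
  shows "Poly_Mapping.lookup p m * Poly_Mapping.lookup q m' \<le> Poly_Mapping.lookup (p * q) (m + m')"
proof (cases "m \<in> Poly_Mapping.keys p \<and> m' \<in> Poly_Mapping.keys q")
  case True
  have nonneg: "0 \<le> Poly_Mapping.lookup p k * Poly_Mapping.lookup q k'" for k k'
    using assms by (simp add: nonneg_coeffs_def)
  let ?c = "\<lambda>k k'. Poly_Mapping.lookup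
    (Poly_Mapping.single (k + k') (Poly_Mapping.lookup p k * Poly_Mapping.lookup q k')) (m + m')"
  have c_nonneg: "0 \<le> ?c k k'" for k k'
    using nonneg by (simp add: lookup_single when_def)
  have "Poly_Mapping.lookup p m * Poly_Mapping.lookup q m' = ?c m m'"
    by simp
  also have "\<dots> \<le> (\<Sum>k'\<in>Poly_Mapping.keys q. ?c m k')"
    by (rule member_le_sum) (use True c_nonneg in auto)
  also have "\<dots> \<le> (\<Sum>k\<in>Poly_Mapping.keys p. \<Sum>k'\<in>Poly_Mapping.keys q. ?c k k')"
    by (rule member_le_sum[where f = "\<lambda>k. \<Sum>k'\<in>Poly_Mapping.keys q. ?c k k'"])
       (use True c_nonneg in \<open>auto intro: sum_nonneg\<close>)
  finally show ?thesis
    by (simp add: mult_eq_sum_single lookup_sum)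
next
  case False
  then show ?thesis
    using nonneg_coeffs_mult[OF assms] by (auto simp: in_keys_iff nonneg_coeffs_def)
qed

lemma total_degree_altdef:
  "total_degree p = Max (insert 0 (monomial_degree ` Poly_Mapping.keys p))"
  by (simp add: total_degree_def monomial_degree_def[abs_def])

lemma monomial_degree_le_total_degree:
  "m \<in> Poly_Mapping.keys p \<Longrightarrow> monomial_degree m \<le> total_degree p"
  unfolding total_degree_altdef by (rule Max_ge) auto

lemma total_degree_attained:
  assumes "p \<noteq> 0"
  obtains m where "m \<in> Poly_Mapping.keys p" "monomial_degree m = total_degree p"
proof -
  have ne: "monomial_degree ` Poly_Mapping.keys p \<noteq> {}"
    using assms by (metis empty_is_image poly_mapping_eq_sum_single sum.empty)
  then have "total_degree p = Max (monomial_degree ` Poly_Mapping.keys p)"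
    by (simp add: total_degree_altdef)
  also have "\<dots> \<in> monomial_degree ` Poly_Mapping.keys p"
    using ne by (intro Max_in) auto
  finally show thesis
    using that by force
qed

lemma total_degree_eqI:
  assumes "m \<in> Poly_Mapping.keys p" "monomial_degree m = d"
    and "\<And>m. m \<in> Poly_Mapping.keys p \<Longrightarrow> monomial_degree m \<le> d"
  shows "total_degree p = d"
  unfolding total_degree_altdef by (rule Max_eqI) (use assms in auto)

text \<open>A sum of two nonnegative coefficients vanishes only if both do. This turns the usual
  upper bound for the degree of a sum into an equality.\<close>

lemma keys_add_nonneg_coeffs:
  assumes "nonneg_coeffs p" "nonneg_coeffs q"
  shows "Poly_Mapping.keys (p + q) = Poly_Mapping.keys p \<union> Poly_Mapping.keys q"
  using assms by (auto simp: in_keys_iff lookup_add nonneg_coeffs_def add_nonneg_eq_0_iff)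

lemma total_degree_add:
  assumes "nonneg_coeffs p" "nonneg_coeffs q"
  shows "total_degree (p + q) = max (total_degree p) (total_degree q)"
proof -
  \<comment> \<open>The \<open>0\<close> is inserted on both sides of the union so that neither set
    is empty and \<open>Max_Un\<close> applies.\<close>
  have "insert 0 (monomial_degree ` Poly_Mapping.keys (p + q)) =
      insert 0 (monomial_degree ` Poly_Mapping.keys p) \<union> insert 0 (monomial_degree ` Poly_Mapping.keys q)"
    by (auto simp: keys_add_nonneg_coeffs[OF assms])
  then show ?thesis
    by (simp only: total_degree_altdef) (subst Max_Un; simp)
qed

lemma mult_keysI:
  assumes "nonneg_coeffs p" "nonneg_coeffs q" "m \<in> Poly_Mapping.keys p" "m' \<in> Poly_Mapping.keys q"
  shows "m + m' \<in> Poly_Mapping.keys (p * q)"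
proof -
  have "0 < Poly_Mapping.lookup p m" "0 < Poly_Mapping.lookup q m'"
    using assms by (auto simp: nonneg_coeffs_def in_keys_iff order_less_le)
  then have "0 < Poly_Mapping.lookup p m * Poly_Mapping.lookup q m'"
    by simp
  also have "\<dots> \<le> Poly_Mapping.lookup (p * q) (m + m')"
    by (rule lookup_mult_ge) fact+
  finally show ?thesis
    by (simp add: in_keys_iff)
qed

lemma mult_nonneg_coeffs_nonzero:
  fixes p q :: "'n::finite real_mpoly"
  assumes "nonneg_coeffs p" "nonneg_coeffs q" "p \<noteq> 0" "q \<noteq> 0"
  shows "p * q \<noteq> 0"
proof -
  obtain m m' where "m \<in> Poly_Mapping.keys p" "m' \<in> Poly_Mapping.keys q"
    using assms(3,4) total_degree_attained by metis
  then have "m + m' \<in> Poly_Mapping.keys (p * q)"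
    using assms mult_keysI by blast
  then show ?thesis
    by (auto simp: in_keys_iff)
qed

lemma add_nonneg_coeffs_nonzero:
  fixes p q :: "'n::finite real_mpoly"
  assumes "nonneg_coeffs p" "nonneg_coeffs q" "p \<noteq> 0"
  shows "p + q \<noteq> 0"
proof -
  obtain m where "m \<in> Poly_Mapping.keys p"
    using assms(3) total_degree_attained by blast
  then have "m \<in> Poly_Mapping.keys (p + q)"
    using keys_add_nonneg_coeffs[OF assms(1,2)] by blast
  then show ?thesis
    by (auto simp: in_keys_iff)
qed

text \<open>Monomials of top degree in \<open>p\<close> and \<open>q\<close> add up to a monomial
  that survives in \<open>p * q\<close>, and every monomial of the product is such a sum. Both
  factors must be nonzero because the zero polynomial has degree \<open>0\<close> here.\<close>

lemma total_degree_mult: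
  assumes "nonneg_coeffs p" "nonneg_coeffs q" "p \<noteq> 0" "q \<noteq> 0"
  shows "total_degree (p * q) = total_degree p + total_degree q"
proof -
  obtain m where m: "m \<in> Poly_Mapping.keys p" "monomial_degree m = total_degree p"
    using total_degree_attained assms(3) .
  obtain m' where m': "m' \<in> Poly_Mapping.keys q" "monomial_degree m' = total_degree q"
    using total_degree_attained assms(4) .
  show ?thesis
  proof (rule total_degree_eqI[OF mult_keysI])
    fix k assume "k \<in> Poly_Mapping.keys (p * q)"
    then obtain a b where "a \<in> Poly_Mapping.keys p" "b \<in> Poly_Mapping.keys q" "k = a + b"
      using keys_mult[of p q] by blast
    then show "monomial_degree k \<le> total_degree p + total_degree q"
      by (simp add: monomial_degree_add add_mono monomial_degree_le_total_degree)
  qed (use assms m m' in \<open>auto simp: monomial_degree_add\<close>)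
qed

lemma continuous_on_mpoly_eval: "continuous_on S (mpoly_eval p)"
  unfolding mpoly_eval_def[abs_def] by (intro continuous_intros)

section \<open>Shifted coordinates\<close>

definition affine_var :: "real \<Rightarrow> 'n \<Rightarrow> 'n::finite real_mpoly" where
  "affine_var a k = Poly_Mapping.single 0 a + Poly_Mapping.single (Poly_Mapping.single k 1) 1"

lemma mpoly_eval_affine_var: "mpoly_eval (affine_var a k) x = a + x $ k"
proof -
  have "monomial_eval (Poly_Mapping.single k 1) x = (\<Prod>i\<in>UNIV. if i = k then x $ i else 1)"
    unfolding monomial_eval_def by (rule prod.cong) (auto simp: lookup_single when_def)
  moreover have "monomial_eval 0 x = 1"
    by (simp add: monomial_eval_def)
  ultimately show ?thesis
    by (simp add: affine_var_def mpoly_eval_add mpoly_eval_single)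
qed

lemma nonneg_coeffs_affine_var: "0 \<le> a \<Longrightarrow> nonneg_coeffs (affine_var a k)"
  by (simp add: affine_var_def nonneg_coeffs_add nonneg_coeffs_single)

lemma affine_var_nonzero: "affine_var a k \<noteq> 0"
proof
  assume "affine_var a k = 0"
  \<comment> \<open>At this point \<open>a + x $ k\<close> equals 1, whatever the sign of
    \<open>a\<close>.\<close>
  then have "mpoly_eval (affine_var a k) (\<chi> i. 1 - a) = 0"
    by simp
  then show False
    by (simp add: mpoly_eval_affine_var)
qed

lemma total_degree_single: "c \<noteq> 0 \<Longrightarrow> total_degree (Poly_Mapping.single m c) = monomial_degree m"
  by (simp add: total_degree_altdef)

lemma total_degree_affine_var:
  fixes k :: "'n::finite"
  assumes "0 < a"
  shows "total_degree (affine_var a k) = 1"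
proof -
  note assms
  moreover have "monomial_degree (Poly_Mapping.single k 1) = 1"
    by (simp add: monomial_degree_def lookup_single when_def)
  moreover have "monomial_degree (0 :: 'n monomial) = 0"
    by (simp add: monomial_degree_def)
  ultimately show ?thesis
    by (simp add: affine_var_def total_degree_add nonneg_coeffs_single total_degree_single)
qed

subsection \<open>Saturated cones of positive functions\<close>

text \<open>A finite subcover reduces a hereditary property that is stable under finite unions to a
  local one. It serves twice below, once for each of two separated compact sets.\<close>

lemma compact_local_induct:
  assumes "compact K" and empty: "Q {}"
    and union: "\<And>A B. Q A \<Longrightarrow> Q B \<Longrightarrow> Q (A \<union> B)"
    and mono: "\<And>A B. A \<subseteq> B \<Longrightarrow> Q B \<Longrightarrow> Q A"
    and local: "\<And>x. x \<in> K \<Longrightarrow> \<exists>U. open U \<and> x \<in> U \<and> Q U"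
  shows "Q K"
proof -
  obtain U where U: "\<And>x. x \<in> K \<Longrightarrow> open (U x) \<and> x \<in> U x \<and> Q (U x)"
    using local by metis
  obtain F where F: "F \<subseteq> K" "finite F" "K \<subseteq> (\<Union>x\<in>F. U x)"
    using compactE_image[OF \<open>compact K\<close>, of K U] U by blast
  have "Q (\<Union>x\<in>F. U x)"
    using \<open>finite F\<close> \<open>F \<subseteq> K\<close> by induction (auto simp: U empty union)
  then show ?thesis
    using mono F(3) by blast
qed

text \<open>These are the only facts about rational functions that the approximation argument uses.
  Subtraction and lattice operations are not among them; the map \<open>f / (1 + f)\<close> takes
  over the role of truncation.\<close>

locale positive_function_cone =
  fixes X :: "'a::topological_space set" and T :: "('a \<Rightarrow> real) set"
  assumes pos: "f \<in> T \<Longrightarrow> x \<in> X \<Longrightarrow> 0 < f x"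
    and const: "0 < c \<Longrightarrow> (\<lambda>_. c) \<in> T"
    and add: "f \<in> T \<Longrightarrow> g \<in> T \<Longrightarrow> (\<lambda>x. f x + g x) \<in> T"
    and mult: "f \<in> T \<Longrightarrow> g \<in> T \<Longrightarrow> (\<lambda>x. f x * g x) \<in> T"
    and saturate: "f \<in> T \<Longrightarrow> (\<lambda>x. f x / (1 + f x)) \<in> T"
    and continuous: "f \<in> T \<Longrightarrow> continuous_on X f"
begin

lemma scale: "0 < c \<Longrightarrow> f \<in> T \<Longrightarrow> (\<lambda>x. c * f x) \<in> T"
  using mult[OF const] .

lemma power: "f \<in> T \<Longrightarrow> (\<lambda>x. f x ^ m) \<in> T"
  by (induction m) (auto intro: mult const)

text \<open>The index range is nonempty since the empty sum \<open>0\<close> need not belong to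
  \<open>T\<close>.\<close>

lemma sum_lessThan_Suc: "(\<And>j. f j \<in> T) \<Longrightarrow> (\<lambda>x. \<Sum>j<Suc n. f j x) \<in> T"
  by (induction n) (auto intro: add)

section \<open>Approximate indicator functions\<close>

text \<open>The relation is directed: \<open>h\<close> is low on \<open>A\<close> and high on
  \<open>B\<close>, and it cannot be reversed by passing to \<open>1 - h\<close>. The bound
  \<open>h < 1\<close> on all of \<open>X\<close> keeps products of such functions below each
  factor.\<close>

definition separable :: "'a set \<Rightarrow> 'a set \<Rightarrow> bool" where
  "separable A B \<longleftrightarrow> (\<forall>\<epsilon>>0. \<exists>h\<in>T. (\<forall>x\<in>X. h x < 1) \<and>
     (\<forall>x\<in>X \<inter> A. h x < \<epsilon>) \<and> (\<forall>x\<in>X \<inter> B. 1 - \<epsilon> < h x))"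

lemma separableE:
  assumes "separable A B" "0 < \<epsilon>"
  obtains h where "h \<in> T" "\<And>x. x \<in> X \<Longrightarrow> h x < 1"
    "\<And>x. x \<in> X \<Longrightarrow> x \<in> A \<Longrightarrow> h x < \<epsilon>" "\<And>x. x \<in> X \<Longrightarrow> x \<in> B \<Longrightarrow> 1 - \<epsilon> < h x"
  using assms unfolding separable_def by blast

lemma separable_mono:
  "separable A B \<Longrightarrow> X \<inter> A' \<subseteq> A \<Longrightarrow> X \<inter> B' \<subseteq> B \<Longrightarrow> separable A' B'"
  unfolding separable_def by (smt (verit) Int_iff subset_iff)

lemma separable_empty_left: "separable {} B"
  unfolding separable_def
proof (intro allI impI)
  fix \<epsilon> :: real assume "0 < \<epsilon>"
  \<comment> \<open>The maximum with \<open>1 / 2\<close> keeps the constant positive when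
    \<open>\<epsilon>\<close> is large.\<close>
  define c where "c = max (1 / 2) (1 - \<epsilon> / 2)"
  have "0 < c" "c < 1" "1 - \<epsilon> < c"
    using \<open>0 < \<epsilon>\<close> by (auto simp: c_def)
  then show "\<exists>h\<in>T. (\<forall>x\<in>X. h x < 1) \<and> (\<forall>x\<in>X \<inter> {}. h x < \<epsilon>) \<and> (\<forall>x\<in>X \<inter> B. 1 - \<epsilon> < h x)"
    by (intro bexI[of _ "\<lambda>_. c"] const) auto
qed

lemma separable_empty_right: "separable A {}"
  unfolding separable_def
proof (intro allI impI)
  fix \<epsilon> :: real assume "0 < \<epsilon>"
  define c where "c = min (1 / 2) (\<epsilon> / 2)"
  have "0 < c" "c < 1" "c < \<epsilon>"
    using \<open>0 < \<epsilon>\<close> by (auto simp: c_def)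
  then show "\<exists>h\<in>T. (\<forall>x\<in>X. h x < 1) \<and> (\<forall>x\<in>X \<inter> A. h x < \<epsilon>) \<and> (\<forall>x\<in>X \<inter> {}. 1 - \<epsilon> < h x)"
    by (intro bexI[of _ "\<lambda>_. c"] const) auto
qed

text \<open>Dividing by \<open>c\<close> between \<open>u\<close> and \<open>v\<close> puts low
  values below 1 and high values above 1. A high power \<open>t\<close> drives them towards 0 and
  infinity, and \<open>t / (1 + t)\<close> brings them back below 1, with
  \<open>t / (1 + t) \<le> t\<close> and \<open>1 - t / (1 + t) \<le> 1 / t\<close>.\<close>

lemma separable_level_sets:
  assumes "f \<in> T" "0 < u" "u < v"
  shows "separable {x. f x \<le> u} {x. v \<le> f x}"
  unfolding separable_def
proof (intro allI impI)
  fix \<epsilon> :: real assume "0 < \<epsilon>"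
  define c where "c = (u + v) / 2"
  have c: "u < c" "c < v" "0 < c"
    using assms by (auto simp: c_def)
  \<comment> \<open>One ratio below 1 that bounds both \<open>f / c\<close> on the low set and
    \<open>c / f\<close> on the high set, so a single exponent \<open>m\<close> serves both
    estimates.\<close>
  define r where "r = max (u / c) (c / v)"
  have r: "0 < r" "r < 1" "u / c \<le> r" "c / v \<le> r"
    using c assms by (auto simp: r_def less_max_iff_disj)
  obtain m where m: "r ^ m < \<epsilon>"
    using real_arch_pow_inv[OF \<open>0 < \<epsilon>\<close> \<open>r < 1\<close>] by blast
  define g where "g = (\<lambda>x. (inverse c * f x) ^ m)"
  have g: "g \<in> T"
    unfolding g_def using c by (intro power scale assms) auto
  have gpos: "0 < g x" if "x \<in> X" for x
    using pos[OF g that] .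
  have fpos: "0 < f x" if "x \<in> X" for x
    using pos[OF assms(1) that] .
  have low: "g x / (1 + g x) < \<epsilon>" if "x \<in> X" "f x \<le> u" for x
  proof -
    have "inverse c * f x \<le> u / c"
      using c that by (simp add: field_simps)
    then have "inverse c * f x \<le> r"
      using r by simp
    then have "g x \<le> r ^ m"
      unfolding g_def by (rule power_mono) (use c fpos[OF that(1)] in auto)
    moreover have "g x / (1 + g x) \<le> g x"
      using gpos[OF that(1)] by (simp add: field_simps)
    ultimately show ?thesis
      using m by linarith
  qed
  have high: "1 - \<epsilon> < g x / (1 + g x)" if "x \<in> X" "v \<le> f x" for x
  proof -
    have "inverse (inverse c * f x) \<le> c / v"
      using c that assms by (simp add: field_simps)
    then have "inverse (inverse c * f x) \<le> r"
      using r by simp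
    then have "inverse (g x) \<le> r ^ m"
      unfolding g_def power_inverse[symmetric]
      by (rule power_mono) (use c fpos[OF that(1)] in auto)
    moreover have "1 - g x / (1 + g x) \<le> inverse (g x)"
      using gpos[OF that(1)] by (simp add: field_simps)
    ultimately show ?thesis
      using m by linarith
  qed
  have less_one: "g x / (1 + g x) < 1" if "x \<in> X" for x
    using gpos[OF that] by simp
  show "\<exists>h\<in>T. (\<forall>x\<in>X. h x < 1) \<and> (\<forall>x\<in>X \<inter> {x. f x \<le> u}. h x < \<epsilon>) \<and>
      (\<forall>x\<in>X \<inter> {x. v \<le> f x}. 1 - \<epsilon> < h x)"
    by (rule bexI[OF _ saturate[OF g]]) (use less_one low high in auto)
qed

text \<open>A product of functions below 1 is small wherever one factor is, and its defect from 1 is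
  at most the sum of the two defects. Hence precision \<open>\<epsilon> / 2\<close> for each factor
  suffices.\<close>

lemma separable_Un_left:
  assumes "separable A B" "separable A' B"
  shows "separable (A \<union> A') B"
  unfolding separable_def
proof (intro allI impI)
  fix \<epsilon> :: real assume "0 < \<epsilon>"
  then have "0 < \<epsilon> / 2" by simp
  obtain h where h: "h \<in> T" "\<And>x. x \<in> X \<Longrightarrow> h x < 1"
    "\<And>x. x \<in> X \<Longrightarrow> x \<in> A \<Longrightarrow> h x < \<epsilon> / 2" "\<And>x. x \<in> X \<Longrightarrow> x \<in> B \<Longrightarrow> 1 - \<epsilon> / 2 < h x"
    by (rule separableE[OF assms(1) \<open>0 < \<epsilon> / 2\<close>]) blast
  obtain k where k: "k \<in> T" "\<And>x. x \<in> X \<Longrightarrow> k x < 1"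
    "\<And>x. x \<in> X \<Longrightarrow> x \<in> A' \<Longrightarrow> k x < \<epsilon> / 2" "\<And>x. x \<in> X \<Longrightarrow> x \<in> B \<Longrightarrow> 1 - \<epsilon> / 2 < k x"
    by (rule separableE[OF assms(2) \<open>0 < \<epsilon> / 2\<close>]) blast
  have hk: "h x * k x < 1" "h x * k x \<le> h x" "h x * k x \<le> k x" "h x + k x - 1 \<le> h x * k x"
    if "x \<in> X" for x
  proof -
    have *: "0 < h x" "h x < 1" "0 < k x" "k x < 1"
      using h k that pos by auto
    then show "h x * k x \<le> h x" "h x * k x \<le> k x"
      by (auto simp: mult_left_le mult_left_le_one_le)
    then show "h x * k x < 1" using * by linarith
    \<comment> \<open>Expanding this product gives exactly the lower bound for
      \<open>h x * k x\<close>.\<close>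
    have "0 \<le> (1 - h x) * (1 - k x)"
      using * by simp
    then show "h x + k x - 1 \<le> h x * k x"
      by (simp add: algebra_simps)
  qed
  have "h x * k x < \<epsilon>" if "x \<in> X" "x \<in> A \<union> A'" for x
    using hk[OF that(1)] h(3)[of x] k(3)[of x] that \<open>0 < \<epsilon>\<close> by auto
  moreover have "1 - \<epsilon> < h x * k x" if "x \<in> X" "x \<in> B" for x
    using hk(4)[OF that(1)] h(4)[OF that] k(4)[OF that] by linarith
  ultimately show "\<exists>h\<in>T. (\<forall>x\<in>X. h x < 1) \<and> (\<forall>x\<in>X \<inter> (A \<union> A'). h x < \<epsilon>) \<and>
      (\<forall>x\<in>X \<inter> B. 1 - \<epsilon> < h x)"
    by (intro bexI[OF _ mult[OF h(1) k(1)]]) (use hk in auto)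
qed

text \<open>A sum is large wherever one summand is, but it need not stay below 1. A fixed precision
  of \<open>1 / 4\<close> already leaves the gap between \<open>1 / 2\<close> and
  \<open>3 / 4\<close>, and \<open>separable_level_sets\<close> then restores arbitrary
  precision.\<close>

lemma separable_Un_right:
  assumes "separable A B" "separable A B'"
  shows "separable A (B \<union> B')"
proof -
  have quarter: "0 < (1 / 4 :: real)" by simp
  obtain h where h: "h \<in> T" "\<And>x. x \<in> X \<Longrightarrow> h x < 1"
    "\<And>x. x \<in> X \<Longrightarrow> x \<in> A \<Longrightarrow> h x < 1 / 4" "\<And>x. x \<in> X \<Longrightarrow> x \<in> B \<Longrightarrow> 1 - 1 / 4 < h x"
    by (rule separableE[OF assms(1) quarter]) blast
  obtain k where k: "k \<in> T" "\<And>x. x \<in> X \<Longrightarrow> k x < 1"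
    "\<And>x. x \<in> X \<Longrightarrow> x \<in> A \<Longrightarrow> k x < 1 / 4" "\<And>x. x \<in> X \<Longrightarrow> x \<in> B' \<Longrightarrow> 1 - 1 / 4 < k x"
    by (rule separableE[OF assms(2) quarter]) blast
  have "separable {x. h x + k x \<le> 1 / 2} {x. 3 / 4 \<le> h x + k x}"
    by (rule separable_level_sets) (use add h k in auto)
  then show ?thesis
  proof (rule separable_mono)
    show "X \<inter> A \<subseteq> {x. h x + k x \<le> 1 / 2}"
      using h(3) k(3) by fastforce
    show "X \<inter> (B \<union> B') \<subseteq> {x. 3 / 4 \<le> h x + k x}"
      using h(4) k(4) pos[OF h(1)] pos[OF k(1)] by fastforce
  qed
qed

lemma separable_neighbourhoods:
  assumes "g \<in> T" "a \<in> X" "b \<in> X" "g a < g b"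
  obtains U V where "open U" "a \<in> U" "open V" "b \<in> V" "separable U V"
proof -
  \<comment> \<open>Two thresholds strictly between \<open>g a\<close> and \<open>g b\<close> leave
    room on both sides: the strict level sets beyond them are relatively open and contain
    \<open>a\<close> and \<open>b\<close>.\<close>
  obtain v where v: "g a < v" "v < g b"
    using dense assms(4) by blast
  obtain u where u: "g a < u" "u < v"
    using dense v(1) by blast
  obtain U where U: "open U" "U \<inter> X = g -` {..<u} \<inter> X"
    using continuous[OF assms(1)] by (metis continuous_on_open_invariant open_lessThan)
  obtain V where V: "open V" "V \<inter> X = g -` {v<..} \<inter> X"
    using continuous[OF assms(1)] by (metis continuous_on_open_invariant open_greaterThan)
  have "0 < u"
    using pos[OF assms(1,2)] u by linarith
  then have "separable {x. g x \<le> u} {x. v \<le> g x}"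
    using separable_level_sets assms(1) u by blast
  then have "separable U V"
    by (rule separable_mono) (use U(2) V(2) in \<open>force+\<close>)
  moreover have "a \<in> U" "b \<in> V"
    using U V u v assms by auto
  ultimately show thesis
    using that U V by blast
qed

text \<open>Compactness is used in two nested rounds. For fixed \<open>b\<close> the set
  \<open>A\<close> is covered while a neighbourhood of \<open>b\<close> is carried along; these
  neighbourhoods then cover \<open>B\<close>.\<close>

lemma separable_compact:
  assumes "compact A" "compact B" "A \<subseteq> X" "B \<subseteq> X"
    and sep: "\<And>a b. a \<in> A \<Longrightarrow> b \<in> B \<Longrightarrow> \<exists>g\<in>T. g a < g b"
  shows "separable A B"
  using assms(2)
proof (rule compact_local_induct)
  fix b assume b: "b \<in> B"
  have "\<exists>V. open V \<and> b \<in> V \<and> separable A V"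
    using assms(1)
  proof (rule compact_local_induct)
    show "\<exists>V. open V \<and> b \<in> V \<and> separable {} V"
      using separable_empty_left by blast
  next
    fix C D assume "\<exists>V. open V \<and> b \<in> V \<and> separable C V" "\<exists>V. open V \<and> b \<in> V \<and> separable D V"
    then obtain V W where "open V" "b \<in> V" "separable C V" "open W" "b \<in> W" "separable D W"
      by blast
    \<comment> \<open>Shrinking to the intersection keeps both separations valid on the same
      neighbourhood of \<open>b\<close>.\<close>
    then have "open (V \<inter> W)" "b \<in> V \<inter> W" "separable (C \<union> D) (V \<inter> W)"
      by (auto intro!: separable_Un_left elim: separable_mono)
    then show "\<exists>V. open V \<and> b \<in> V \<and> separable (C \<union> D) V"
      by blast
  next
    fix C D assume "C \<subseteq> D" "\<exists>V. open V \<and> b \<in> V \<and> separable D V"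
    then show "\<exists>V. open V \<and> b \<in> V \<and> separable C V"
      using separable_mono[of D _ C] by blast
  next
    fix a assume "a \<in> A"
    then obtain g where "g \<in> T" "g a < g b"
      using sep b by blast
    moreover have "a \<in> X" "b \<in> X"
      using \<open>a \<in> A\<close> b assms(3,4) by auto
    ultimately obtain U V where "open U" "a \<in> U" "open V" "b \<in> V" "separable U V"
      using separable_neighbourhoods by metis
    then show "\<exists>U. open U \<and> a \<in> U \<and> (\<exists>V. open V \<and> b \<in> V \<and> separable U V)"
      by blast
  qed
  then show "\<exists>V. open V \<and> b \<in> V \<and> separable A V" .
next
  fix C D assume "C \<subseteq> D" "separable A D"
  then show "separable A C"
    using separable_mono[of A D A C] by blast
qed (auto intro: separable_empty_right separable_Un_right)

section \<open>Decomposition into layers and uniform approximation\<close>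

text \<open>Each ramp is the part of \<open>t\<close> lying in the layer from
  \<open>j * \<delta>\<close> to \<open>(j + 1) * \<delta>\<close>. The approximating sum can thus
  be compared with \<open>f\<close> layer by layer.\<close>

lemma sum_ramps:
  fixes t \<delta> :: real
  assumes "0 \<le> t" "0 \<le> \<delta>"
  shows "(\<Sum>j<n. max 0 (min \<delta> (t - real j * \<delta>))) = min t (real n * \<delta>)"
  by (induction n) (use assms in \<open>auto simp: algebra_simps min_def max_def\<close>)

theorem uniform_approximation:
  assumes "compact X" "continuous_on X f" and nonneg: "\<And>x. x \<in> X \<Longrightarrow> 0 \<le> f x"
    and sep: "\<And>x y. x \<in> X \<Longrightarrow> y \<in> X \<Longrightarrow> f x < f y \<Longrightarrow> \<exists>g\<in>T. g x < g y"
    and "0 < \<epsilon>"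
  obtains g where "g \<in> T" "\<And>x. x \<in> X \<Longrightarrow> \<bar>f x - g x\<bar> < \<epsilon>"
proof -
  \<comment> \<open>The total error will be at most \<open>2 * \<delta>\<close>: one
    \<open>\<delta>\<close> from the layer containing \<open>f x\<close>, one from all the layers
    together.\<close>
  define \<delta> where "\<delta> = \<epsilon> / 3"
  have "0 < \<delta>" using \<open>0 < \<epsilon>\<close> by (simp add: \<delta>_def)
  obtain M where M: "\<And>x. x \<in> X \<Longrightarrow> f x \<le> M"
    using bounded_imp_bdd_above[OF compact_imp_bounded[OF compact_continuous_image[OF assms(2,1)]]]
    by (auto simp: bdd_above_def)
  obtain n :: nat where "M / \<delta> \<le> real n"
    using real_arch_simple by blast
  then have "M \<le> real n * \<delta>"
    using \<open>0 < \<delta>\<close> by (simp add: field_simps)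
  also have "\<dots> \<le> real (Suc n) * \<delta>"
    using \<open>0 < \<delta>\<close> by (intro mult_right_mono) auto
  finally have fN: "f x \<le> real (Suc n) * \<delta>" if "x \<in> X" for x
    using M that by fastforce
  \<comment> \<open>Level sets of \<open>f\<close> are closed in the compact \<open>X\<close>, and
    \<open>sep\<close> separates their points because \<open>u < v\<close> forces a strict
    inequality of values.\<close>
  have level: "separable {x \<in> X. f x \<le> u} {x \<in> X. v \<le> f x}" if "u < v" for u v
  proof (rule separable_compact)
    have "closedin (top_of_set X) (X \<inter> f -` {..u})" "closedin (top_of_set X) (X \<inter> f -` {v..})"
      using assms(2) by (auto intro: continuous_closedin_preimage)
    then have "compact (X \<inter> f -` {..u})" "compact (X \<inter> f -` {v..})"
      using closedin_compact assms(1) by blast+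
    moreover have "X \<inter> f -` {..u} = {x \<in> X. f x \<le> u}" "X \<inter> f -` {v..} = {x \<in> X. v \<le> f x}"
      by auto
    ultimately show "compact {x \<in> X. f x \<le> u}" "compact {x \<in> X. v \<le> f x}"
      by simp_all
  qed (use sep that in auto)
  \<comment> \<open>With \<open>Suc n\<close> layers, precision \<open>1 / Suc n\<close> makes the
    accumulated error \<open>\<delta>\<close>.\<close>
  have "\<exists>h\<in>T. (\<forall>x\<in>X. h x < 1 \<and> (f x \<le> real j * \<delta> \<longrightarrow> h x < 1 / Suc n) \<and>
      (real (Suc j) * \<delta> \<le> f x \<longrightarrow> 1 - 1 / Suc n < h x))" for j
  proof -
    have "real j * \<delta> < real (Suc j) * \<delta>" "0 < 1 / real (Suc n)"
      using \<open>0 < \<delta>\<close> by auto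
    then obtain h where "h \<in> T" "\<And>x. x \<in> X \<Longrightarrow> h x < 1"
      "\<And>x. x \<in> X \<Longrightarrow> x \<in> {x \<in> X. f x \<le> real j * \<delta>} \<Longrightarrow> h x < 1 / Suc n"
      "\<And>x. x \<in> X \<Longrightarrow> x \<in> {x \<in> X. real (Suc j) * \<delta> \<le> f x} \<Longrightarrow> 1 - 1 / Suc n < h x"
      by (rule separableE[OF level]) blast
    then show ?thesis
      by auto
  qed
  then obtain h where h: "\<And>j. h j \<in> T" "\<And>j x. x \<in> X \<Longrightarrow> h j x < 1"
    "\<And>j x. x \<in> X \<Longrightarrow> f x \<le> real j * \<delta> \<Longrightarrow> h j x < 1 / Suc n"
    "\<And>j x. x \<in> X \<Longrightarrow> real (Suc j) * \<delta> \<le> f x \<Longrightarrow> 1 - 1 / Suc n < h j x"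
    by metis
  define g where "g = (\<lambda>x. \<Sum>j<Suc n. \<delta> * h j x)"
  show thesis
  proof (rule that)
    show "g \<in> T"
      unfolding g_def by (intro sum_lessThan_Suc scale h \<open>0 < \<delta>\<close>)
    fix x assume x: "x \<in> X"
    define r where "r j = max 0 (min \<delta> (f x - real j * \<delta>))" for j
    define i where "i = nat \<lfloor>f x / \<delta>\<rfloor>"
    have fx: "0 \<le> f x / \<delta>"
      using nonneg[OF x] \<open>0 < \<delta>\<close> by simp
    have "real i \<le> f x / \<delta>" "f x / \<delta> < real (Suc i)"
      unfolding i_def using fx by linarith+
    then have i: "real i * \<delta> \<le> f x" "f x < real (Suc i) * \<delta>"
      using \<open>0 < \<delta>\<close> by (auto simp: field_simps)
    \<comment> \<open>Layers below \<open>i\<close> are full and \<open>h j\<close> is near 1;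
      layers above \<open>i\<close> are empty and \<open>h j\<close> is near 0. In layer
      \<open>i\<close> itself nothing is known beyond both quantities lying between 0 and
      \<open>\<delta>\<close>.\<close>
    have term_bound: "\<bar>r j - \<delta> * h j x\<bar> \<le> \<delta> / Suc n + (if j = i then \<delta> else 0)" for j
    proof -
      have hj: "0 < h j x" "h j x < 1"
        using pos[OF h(1) x] h(2)[OF x] by auto
      consider "j = i" | "j < i" | "i < j" by linarith
      then show ?thesis
      proof cases
        case 1
        have "0 < \<delta> * h j x" "\<delta> * h j x < \<delta>"
          using hj \<open>0 < \<delta>\<close> by auto
        moreover have "0 \<le> r j" "r j \<le> \<delta>"
          using \<open>0 < \<delta>\<close> by (auto simp: r_def)
        ultimately have "\<bar>r j - \<delta> * h j x\<bar> \<le> \<delta>"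
          by linarith
        then show ?thesis
          using 1 \<open>0 < \<delta>\<close> by (simp add: add_increasing)
      next
        case 2
        then have "real (Suc j) * \<delta> \<le> real i * \<delta>"
          using \<open>0 < \<delta>\<close> by (intro mult_right_mono) auto
        then have le: "real (Suc j) * \<delta> \<le> f x"
          using i by linarith
        then have "r j = \<delta>"
          using \<open>0 < \<delta>\<close> by (auto simp: r_def algebra_simps)
        moreover have "\<delta> * (1 - h j x) \<le> \<delta> * (1 / Suc n)"
          using h(4)[OF x le] \<open>0 < \<delta>\<close> by (intro mult_left_mono) auto
        moreover have "0 \<le> \<delta> * (1 - h j x)"
          using hj \<open>0 < \<delta>\<close> by simp
        ultimately show ?thesis
          using 2 by (simp add: algebra_simps)
      next
        case 3
        then have "real (Suc i) * \<delta> \<le> real j * \<delta>"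
          using \<open>0 < \<delta>\<close> by (intro mult_right_mono) auto
        then have le: "f x \<le> real j * \<delta>"
          using i by linarith
        then have "r j = 0"
          using \<open>0 < \<delta>\<close> by (auto simp: r_def)
        moreover have "\<delta> * h j x \<le> \<delta> * (1 / Suc n)"
          using h(3)[OF x le] \<open>0 < \<delta>\<close> by (intro mult_left_mono) auto
        moreover have "0 \<le> \<delta> * h j x"
          using hj \<open>0 < \<delta>\<close> by simp
        ultimately show ?thesis
          using 3 by simp
      qed
    qed
    have "f x = (\<Sum>j<Suc n. r j)"
      unfolding r_def using sum_ramps[of "f x" \<delta> "Suc n"] nonneg[OF x] fN[OF x] \<open>0 < \<delta>\<close> by simp
    then have "\<bar>f x - g x\<bar> = \<bar>\<Sum>j<Suc n. r j - \<delta> * h j x\<bar>"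
      by (simp only: g_def sum_subtractf)
    also have "\<dots> \<le> (\<Sum>j<Suc n. \<delta> / Suc n + (if j = i then \<delta> else 0))"
      by (rule order_trans[OF sum_abs]) (rule sum_mono, rule term_bound)
    \<comment> \<open>If \<open>f x\<close> equals \<open>Suc n * \<delta>\<close>, then
      \<open>i\<close> is \<open>Suc n\<close> and no summand is exceptional.\<close>
    also have "\<dots> = \<delta> + (if i < Suc n then \<delta> else 0)"
      by (simp only: sum.distrib) (simp add: sum.delta del: sum.lessThan_Suc)
    also have "\<dots> < \<epsilon>"
      using \<open>0 < \<delta>\<close> by (simp add: \<delta>_def)
    finally show "\<bar>f x - g x\<bar> < \<epsilon>" .
  qed
qed

end

subsection \<open>Isotone rational functions\<close>

text \<open>Here \<open>f\<close> is fixed only on \<open>X\<close>, which fits pointwise operations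
  on total functions. The conditions \<open>p \<noteq> 0\<close> and \<open>q \<noteq> 0\<close>
  make degrees of products add, even for empty \<open>X\<close>.\<close>

definition isotone_quotients :: "(real ^ 'n) set \<Rightarrow> (real ^ 'n \<Rightarrow> real) set" where
  "isotone_quotients X =
     {f. (\<forall>x\<in>X. 0 < f x) \<and> mono_on X f \<and>
         (\<exists>p q. nonneg_coeffs p \<and> nonneg_coeffs q \<and> p \<noteq> 0 \<and> q \<noteq> 0 \<and>
            total_degree p = total_degree q \<and>
            (\<forall>x\<in>X. mpoly_eval q x \<noteq> 0 \<and> f x = mpoly_eval p x / mpoly_eval q x))}"

lemma isotone_quotientsI:
  assumes "\<And>x. x \<in> X \<Longrightarrow> 0 < f x" "mono_on X f"
    and "nonneg_coeffs p" "nonneg_coeffs q" "p \<noteq> 0" "q \<noteq> 0" "total_degree p = total_degree q"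
    and "\<And>x. x \<in> X \<Longrightarrow> mpoly_eval q x \<noteq> 0 \<and> f x = mpoly_eval p x / mpoly_eval q x"
  shows "f \<in> isotone_quotients X"
  unfolding isotone_quotients_def using assms by blast

lemma isotone_quotientsE:
  assumes "f \<in> isotone_quotients X"
  obtains p q where "\<And>x. x \<in> X \<Longrightarrow> 0 < f x" "mono_on X f"
    "nonneg_coeffs p" "nonneg_coeffs q" "p \<noteq> 0" "q \<noteq> 0" "total_degree p = total_degree q"
    "\<And>x. x \<in> X \<Longrightarrow> mpoly_eval q x \<noteq> 0" "\<And>x. x \<in> X \<Longrightarrow> f x = mpoly_eval p x / mpoly_eval q x"
  using assms unfolding isotone_quotients_def by blast

lemma restrict_isotone_quotients:
  assumes "f \<in> isotone_quotients X"
  shows "restrict f X \<in> isotone_rational X"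
proof -
  obtain p q where f: "\<And>x. x \<in> X \<Longrightarrow> 0 < f x" "mono_on X f" and pq: "nonneg_coeffs p"
    "nonneg_coeffs q" "p \<noteq> 0" "q \<noteq> 0" "total_degree p = total_degree q"
    "\<And>x. x \<in> X \<Longrightarrow> mpoly_eval q x \<noteq> 0"
    and eq: "\<And>x. x \<in> X \<Longrightarrow> f x = mpoly_eval p x / mpoly_eval q x"
    using assms by (rule isotone_quotientsE) blast
  have "restrict f X = restrict (\<lambda>x. mpoly_eval p x / mpoly_eval q x) X"
    using eq by (auto simp: restrict_def)
  moreover have "\<forall>x\<in>X. 0 < restrict f X x" "mono_on X (restrict f X)"
    using f by (auto simp: mono_on_def)
  ultimately show ?thesis
    unfolding isotone_rational_def using pq by blast
qed

lemma positive_function_cone_isotone_quotients: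
  "positive_function_cone X (isotone_quotients X)"
proof
  fix f x assume "f \<in> isotone_quotients X" "x \<in> X"
  then show "0 < f x"
    by (simp add: isotone_quotients_def)
next
  have single_nonzero: "Poly_Mapping.single 0 d \<noteq> (0 :: 'a real_mpoly)" if "d \<noteq> 0" for d
    using that by (metis lookup_single_eq lookup_zero)
  fix c :: real assume "0 < c"
  then show "(\<lambda>_. c) \<in> isotone_quotients X"
    using \<open>0 < c\<close>
    by (intro isotone_quotientsI[where p = "Poly_Mapping.single 0 c" and q = "Poly_Mapping.single 0 1"])
       (auto simp: nonneg_coeffs_single total_degree_single single_nonzero mpoly_eval_single monomial_eval_def
          monotone_on_def simp del: single_one)
next
  fix f g assume "f \<in> isotone_quotients X" "g \<in> isotone_quotients X"
  obtain p q where f: "\<And>x. x \<in> X \<Longrightarrow> 0 < f x" "mono_on X f" and pq: "nonneg_coeffs p"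
    "nonneg_coeffs q" "p \<noteq> 0" "q \<noteq> 0" "total_degree p = total_degree q"
    "\<And>x. x \<in> X \<Longrightarrow> mpoly_eval q x \<noteq> 0" "\<And>x. x \<in> X \<Longrightarrow> f x = mpoly_eval p x / mpoly_eval q x"
    using \<open>f \<in> isotone_quotients X\<close> by (rule isotone_quotientsE) blast
  obtain p' q' where g: "\<And>x. x \<in> X \<Longrightarrow> 0 < g x" "mono_on X g" and p'q': "nonneg_coeffs p'"
    "nonneg_coeffs q'" "p' \<noteq> 0" "q' \<noteq> 0" "total_degree p' = total_degree q'"
    "\<And>x. x \<in> X \<Longrightarrow> mpoly_eval q' x \<noteq> 0" "\<And>x. x \<in> X \<Longrightarrow> g x = mpoly_eval p' x / mpoly_eval q' x"
    using \<open>g \<in> isotone_quotients X\<close> by (rule isotone_quotientsE) blast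
  note closure = nonneg_coeffs_add nonneg_coeffs_mult mult_nonneg_coeffs_nonzero
    add_nonneg_coeffs_nonzero total_degree_add total_degree_mult
  \<comment> \<open>Both terms of the numerator have degree
    \<open>total_degree q + total_degree q'\<close>, and nothing cancels.\<close>
  show "(\<lambda>x. f x + g x) \<in> isotone_quotients X"
  proof (rule isotone_quotientsI[where p = "p * q' + p' * q" and q = "q * q'"])
    show "mono_on X (\<lambda>x. f x + g x)"
      using f g by (auto simp: monotone_on_def intro: add_mono)
    show "p * q' + p' * q \<noteq> 0" "total_degree (p * q' + p' * q) = total_degree (q * q')"
      using pq p'q' by (auto simp: closure)
    show "0 < f x + g x" if "x \<in> X" for x
      using f(1) g(1) that by (simp add: add_pos_pos)
    show "mpoly_eval (q * q') x \<noteq> 0 \<and>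
        f x + g x = mpoly_eval (p * q' + p' * q) x / mpoly_eval (q * q') x" if "x \<in> X" for x
      using pq(6,7)[OF that] p'q'(6,7)[OF that]
      by (simp add: mpoly_eval_add mpoly_eval_mult add_frac_eq)
  qed (use pq p'q' in \<open>auto simp: closure\<close>)
  show "(\<lambda>x. f x * g x) \<in> isotone_quotients X"
  proof (rule isotone_quotientsI[where p = "p * p'" and q = "q * q'"])
    show "mono_on X (\<lambda>x. f x * g x)"
      using f g by (auto simp: monotone_on_def less_imp_le intro!: mult_mono)
    show "0 < f x * g x" if "x \<in> X" for x
      using f(1) g(1) that by simp
  qed (use pq p'q' in \<open>auto simp: closure mpoly_eval_mult\<close>)
next
  fix f assume "f \<in> isotone_quotients X"
  then obtain p q where f: "\<And>x. x \<in> X \<Longrightarrow> 0 < f x" "mono_on X f" and pq: "nonneg_coeffs p"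
    "nonneg_coeffs q" "p \<noteq> 0" "q \<noteq> 0" "total_degree p = total_degree q"
    "\<And>x. x \<in> X \<Longrightarrow> mpoly_eval q x \<noteq> 0" "\<And>x. x \<in> X \<Longrightarrow> f x = mpoly_eval p x / mpoly_eval q x"
    by (rule isotone_quotientsE) blast
  show "(\<lambda>x. f x / (1 + f x)) \<in> isotone_quotients X"
  proof (rule isotone_quotientsI[where p = p and q = "q + p"])
    show "0 < f x / (1 + f x)" if "x \<in> X" for x
      using f(1)[OF that] by simp
    show "mono_on X (\<lambda>x. f x / (1 + f x))"
    proof (rule mono_onI)
      fix x y assume "x \<in> X" "y \<in> X" "x \<le> y"
      then have "0 < f x" "0 < f y" "f x \<le> f y"
        using f by (auto simp: monotone_on_def)
      then show "f x / (1 + f x) \<le> f y / (1 + f y)"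
        by (simp add: field_simps)
    qed
    fix x assume x: "x \<in> X"
    \<comment> \<open>Coordinates in \<open>X\<close> may be negative, so the signs of the
      coefficients do not show that \<open>q + p\<close> has no zero; this factorisation with
      \<open>f x > 0\<close> does.\<close>
    have "mpoly_eval (q + p) x = mpoly_eval q x * (1 + f x)"
      using pq(6,7)[OF x] by (simp add: mpoly_eval_add field_simps)
    then show "mpoly_eval (q + p) x \<noteq> 0 \<and> f x / (1 + f x) = mpoly_eval p x / mpoly_eval (q + p) x"
      using pq(6,7)[OF x] f(1)[OF x] by simp
  qed (use pq in \<open>auto simp: nonneg_coeffs_add add_nonneg_coeffs_nonzero total_degree_add\<close>)
  have "continuous_on X (\<lambda>x. mpoly_eval p x / mpoly_eval q x)"
    using pq(6) by (intro continuous_on_divide continuous_on_mpoly_eval) auto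
  then show "continuous_on X f"
    using pq(7) by (simp cong: continuous_on_cong)
qed

text \<open>Some coordinate satisfies \<open>x $ k < y $ k\<close>. The function
  \<open>(a + t) / (a + 1 + t) = 1 - 1 / (a + 1 + t)\<close> is strictly increasing in that
  coordinate, and its numerator and denominator both have degree 1.\<close>

lemma exists_isotone_quotient_less:
  fixes X :: "(real ^ 'n) set"
  assumes "bounded X" "x \<in> X" "y \<in> X" "\<not> y \<le> x"
  shows "\<exists>g\<in>isotone_quotients X. g x < g y"
proof -
  obtain k where k: "x $ k < y $ k"
    using assms(4) by (auto simp: less_eq_vec_def not_le)
  obtain M where "M > 0" "\<And>z. z \<in> X \<Longrightarrow> norm z \<le> M"
    using assms(1) bounded_pos by blast
  then have M: "- M \<le> z $ k" if "z \<in> X" for z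
    using component_le_norm_cart[of z k] that by force
  \<comment> \<open>Exceeding the norm bound \<open>M\<close> makes \<open>a + z $ k\<close>
    positive on all of \<open>X\<close>.\<close>
  define a where "a = M + 1"
  have a: "0 < a" "0 < a + z $ k" if "z \<in> X" for z
    using M[OF that] \<open>M > 0\<close> by (auto simp: a_def)
  define g where "g z = (a + z $ k) / (a + 1 + z $ k)" for z :: "real ^ 'n"
  have g_less: "g z \<le> g w \<longleftrightarrow> z $ k \<le> w $ k" if "z \<in> X" "w \<in> X" for z w
  proof -
    have "0 < a + 1 + z $ k" "0 < a + 1 + w $ k"
      using a that by fastforce+
    then show ?thesis
      by (simp add: g_def divide_simps algebra_simps)
  qed
  have "g \<in> isotone_quotients X"
  proof (rule isotone_quotientsI[where p = "affine_var a k" and q = "affine_var (a + 1) k"])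
    show "0 < g z" if "z \<in> X" for z
      using a(2)[OF that] by (simp add: g_def)
    show "mono_on X g"
      by (rule mono_onI) (simp add: g_less less_eq_vec_def)
    show "mpoly_eval (affine_var (a + 1) k) z \<noteq> 0 \<and>
        g z = mpoly_eval (affine_var a k) z / mpoly_eval (affine_var (a + 1) k) z" if "z \<in> X" for z
      using a(2)[OF that] by (simp add: g_def mpoly_eval_affine_var)
  qed (use a(1)[OF assms(2)] in \<open>auto simp: nonneg_coeffs_affine_var affine_var_nonzero total_degree_affine_var\<close>)
  moreover have "g x < g y"
    using g_less[OF assms(3,2)] k by simp
  ultimately show ?thesis
    by blast
qed

section \<open>The closure in the supremum metric\<close>

lemma mspace_cont_space:
  assumes "compact X"
  shows "mspace (cont_space X) = {f. f \<in> extensional X \<and> continuous_on X f}"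
proof -
  have "compactin (top_of_set X) (topspace (top_of_set X))"
    using assms by (simp add: compactin_subtopology)
  then show ?thesis
    by (subst compactin_mspace_cfunspace) auto
qed

lemma isotone_rational_subset:
  assumes "compact X"
  shows "isotone_rational X \<subseteq> nonneg_isotone_cont X"
proof
  fix f assume "f \<in> isotone_rational X"
  then obtain p q where f: "\<forall>x\<in>X. 0 < f x" "mono_on X f" "\<forall>x\<in>X. mpoly_eval q x \<noteq> 0"
    "f = restrict (\<lambda>x. mpoly_eval p x / mpoly_eval q x) X"
    unfolding isotone_rational_def by blast
  have "continuous_on X (\<lambda>x. mpoly_eval p x / mpoly_eval q x)"
    using f(3) by (intro continuous_on_divide continuous_on_mpoly_eval) auto
  then have "continuous_on X f"
    using f(4) by (simp cong: continuous_on_cong)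
  then show "f \<in> nonneg_isotone_cont X"
    unfolding nonneg_isotone_cont_def mspace_cont_space[OF assms]
    using f by (auto simp: less_imp_le)
qed

lemma in_closure_of_mtopology_of:
  "f \<in> mtopology_of m closure_of S \<longleftrightarrow>
     f \<in> mspace m \<and> (\<forall>r>0. \<exists>g\<in>S. g \<in> mspace m \<and> mdist m f g < r)"
proof -
  interpret Metric_space "mspace m" "mdist m"
    by (rule Metric_space_mspace_mdist)
  show ?thesis
    by (auto simp: mtopology_of_def metric_closure_of)
qed

theorem theorem1p12:
  fixes X :: "(real ^ 'n) set"
  assumes "compact X"
  shows "mtopology_of (cont_space X) closure_of isotone_rational X = nonneg_isotone_cont X"
proof (intro subset_antisym subsetI)
  fix f assume "f \<in> mtopology_of (cont_space X) closure_of isotone_rational X"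
  then have f: "f \<in> mspace (cont_space X)"
    and approx: "\<And>r. 0 < r \<Longrightarrow> \<exists>g\<in>isotone_rational X. g \<in> mspace (cont_space X) \<and> mdist (cont_space X) f g < r"
    by (auto simp: in_closure_of_mtopology_of)
  have close: "\<exists>g\<in>isotone_rational X. \<forall>x\<in>X. \<bar>f x - g x\<bar> \<le> r" if "0 < r" for r :: real
  proof -
    obtain g where g: "g \<in> isotone_rational X" "g \<in> mspace (cont_space X)" "mdist (cont_space X) f g < r"
      using approx \<open>0 < r\<close> by blast
    have "\<bar>f x - g x\<bar> \<le> r" if "x \<in> X" for x
      using mdist_cfunspace_imp_mdist_le[OF f g(2) less_imp_le[OF g(3)]] that by (simp add: dist_real_def)
    then show ?thesis
      using g(1) by blast
  qed
  \<comment> \<open>Strict positivity weakens to nonnegativity in the limit, while isotonicity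
    survives as it is.\<close>
  have "0 \<le> f x" if "x \<in> X" for x
  proof (rule field_le_epsilon)
    fix r :: real assume "0 < r"
    then obtain g where "g \<in> isotone_rational X" "\<forall>x\<in>X. \<bar>f x - g x\<bar> \<le> r"
      using close by blast
    moreover have "0 < g x"
      using calculation that by (auto simp: isotone_rational_def)
    ultimately show "0 \<le> f x + r"
      using that by (smt (verit))
  qed
  moreover have "mono_on X f"
  proof (rule mono_onI, rule field_le_epsilon)
    fix x y and r :: real assume xy: "x \<in> X" "y \<in> X" "x \<le> y" and "0 < r"
    then obtain g where g: "g \<in> isotone_rational X" "\<forall>x\<in>X. \<bar>f x - g x\<bar> \<le> r / 2"
      using close[of "r / 2"] by auto
    have "g x \<le> g y"
      using g(1) xy by (auto simp: isotone_rational_def monotone_on_def)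
    moreover have "\<bar>f x - g x\<bar> \<le> r / 2" "\<bar>f y - g y\<bar> \<le> r / 2"
      using g(2) xy by auto
    ultimately show "f x \<le> f y + r"
      by linarith
  qed
  ultimately show "f \<in> nonneg_isotone_cont X"
    using f by (simp add: nonneg_isotone_cont_def)
next
  fix f assume "f \<in> nonneg_isotone_cont X"
  then have f: "f \<in> mspace (cont_space X)" "\<And>x. x \<in> X \<Longrightarrow> 0 \<le> f x" "mono_on X f"
    by (auto simp: nonneg_isotone_cont_def)
  have cont: "continuous_on X f"
    using f(1) unfolding mspace_cont_space[OF assms] by simp
  interpret positive_function_cone X "isotone_quotients X"
    by (rule positive_function_cone_isotone_quotients)
  \<comment> \<open>As \<open>f\<close> is isotone, \<open>f x < f y\<close> excludes
    \<open>y \<le> x\<close>, so a quotient with the right direction exists.\<close>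
  have sep: "\<exists>g\<in>isotone_quotients X. g x < g y" if "x \<in> X" "y \<in> X" "f x < f y" for x y
    using that f(3) compact_imp_bounded[OF assms]
    by (intro exists_isotone_quotient_less) (auto simp: monotone_on_def not_le[symmetric])
  have "\<exists>g\<in>isotone_rational X. g \<in> mspace (cont_space X) \<and> mdist (cont_space X) f g < r"
    if "0 < r" for r
  proof -
    \<comment> \<open>Strict pointwise bounds give only a weak bound on the supremum, hence
      \<open>r / 2\<close>.\<close>
    obtain g where g: "g \<in> isotone_quotients X" "\<And>x. x \<in> X \<Longrightarrow> \<bar>f x - g x\<bar> < r / 2"
      using uniform_approximation[OF assms cont f(2) sep, of "r / 2"] \<open>0 < r\<close> by auto
    have "mdist (cont_space X) f (restrict g X) \<le> r / 2"
      using g(2) \<open>0 < r\<close> by (intro mdist_cfunspace_le) (auto simp: dist_real_def less_imp_le)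
    moreover have "restrict g X \<in> isotone_rational X"
      using g(1) by (rule restrict_isotone_quotients)
    moreover have "restrict g X \<in> mspace (cont_space X)"
      using isotone_rational_subset[OF assms] calculation(2) by (auto simp: nonneg_isotone_cont_def)
    ultimately show ?thesis
      using \<open>0 < r\<close> by (intro bexI[of _ "restrict g X"]) auto
  qed
  then show "f \<in> mtopology_of (cont_space X) closure_of isotone_rational X"
    using f(1) by (simp add: in_closure_of_mtopology_of)
qed

end
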